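(* Let $\lambda\in\mathbb{F}_{q^n}\setminus\mathbb{F}_q$ and $\mathbb{F}_q(\lambda)=\mathbb{F}_{q^t}$. Let $$S=\overline{S}\oplus b\langle 1,\lambda,\dots,\lambda^{m-1}\rangle_{\mathbb{F}_q},$$ where $\overline{S}$ is an $\mathbb{F}_{q^t}$-subspace of $\mathbb{F}_{q^n}$ of $\mathbb{F}_{q^t}$-dimension $\ell>0$, $b\in\mathbb{F}_{q^n}\setminus\overline{S}$ and $0<m<t$. Suppose that one of the following two conditions holds: (a) $(t,m)\neq(2,1)$; (b) $(t,m)=(2,1)$ and $\mathbb{F}_{q^2}\subsetneq H(\langle S\rangle_{\mathbb{F}_{q^2}})$. Then $\mathrm{Orb}(S)$ is not an FWS code.
   Context: $q$ is a prime power. $\mathcal{G}_q(n,k)$ is the set of all $k$-dimensional $\mathbb{F}_q$-subspaces of $\mathbb{F}_{q^n}$, with distance $d(U,V)=2k-2\dim_{\mathbb{F}_q}(U\cap V)$. For $S\in\mathcal{G}_q(n,k)$, $\mathrm{Orb}(S)=\{\alpha S:\alpha\in\mathbb{F}_{q^n}^*\}$. For $\mathcal{C}=\mathrm{Orb}(S)$ and $i\in\{1,\dots,k\}$ put $\omega_{2i}(\mathcal{C})=|\{\alpha S\in\mathrm{Orb}(S): d(S,\alpha S)=2i\}|$; $\mathcal{C}$ is a full weight spectrum (FWS) code if $\omega_{2i}(\mathcal{C})>0$ for every $i\in\{1,\dots,k\}$, where $k=\dim_{\mathbb{F}_q}S$. For a subspace $U$ of $\mathbb{F}_{q^n}$,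 $H(U)=\{x\in\mathbb{F}_{q^n}^*: xU=U\}\cup\{0\}$ is its stabilizer (a subfield of $\mathbb{F}_{q^n}$). $\langle\cdot\rangle_{\mathbb{F}}$ denotes the $\mathbb{F}$-linear span. *)

theory Defs
  imports "HOL-Algebra.Algebra" "HOL-Number_Theory.Prime_Powers"
begin

text \<open>
  The ambient ring is the field with \<open>q\<^sup>n\<close> elements and \<open>K\<close> is one of its subfields. The
  \<open>K\<close>-subspaces are the library's \<open>subalgebra K U R\<close>: additive subgroups closed under
  multiplication by \<open>K\<close>.
\<close>

context ring
begin

text \<open>
  For \<open>U\<close> and \<open>V\<close> of the same dimension \<open>k\<close>, this is \<open>2k - 2 dim (U \<inter> V)\<close>; it is
  integer-valued so that the subtraction does not truncate.
\<close>

definition subspace_dist :: "'a set \<Rightarrow> 'a set \<Rightarrow> 'a set \<Rightarrow> int" where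
  "subspace_dist K U V = 2 * int ((dim over K) U) - 2 * int ((dim over K) (U \<inter> V))"

definition Orb :: "'a set \<Rightarrow> 'a set set" where
  "Orb S = {\<alpha> <# S | \<alpha>. \<alpha> \<in> carrier R - {\<zero>}}"

text \<open>The number of codewords of \<open>Orb S\<close> (as subspaces, not scalars) at distance \<open>2i\<close> from \<open>S\<close>.\<close>

definition weight :: "'a set \<Rightarrow> 'a set \<Rightarrow> nat \<Rightarrow> nat" where
  "weight K S i = card {V \<in> Orb S. subspace_dist K S V = 2 * int i}"

text \<open>
  A property of the code \<open>Orb S\<close>, expressed through its generator \<open>S\<close>. It does not depend on
  the choice of \<open>S\<close> in the orbit, as multiplication by a nonzero scalar preserves the distance.
\<close>

definition full_weight_spectrum :: "'a set \<Rightarrow> 'a set \<Rightarrow> bool" where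
  "full_weight_spectrum K S \<longleftrightarrow> (\<forall>i\<in>{1..(dim over K) S}. weight K S i > 0)"

definition stabilizer :: "'a set \<Rightarrow> 'a set" where
  "stabilizer U = {x \<in> carrier R - {\<zero>}. x <# U = U} \<union> {\<zero>}"

text \<open>The library's \<open>Span\<close> takes a list of generators; this is the span of a set.\<close>

definition span_set :: "'a set \<Rightarrow> 'a set \<Rightarrow> 'a set" where
  "span_set K A = (\<Union>us\<in>{us. set us \<subseteq> A}. Span K us)"

lemma span_set_set:
  assumes "subfield K R" "set Us \<subseteq> carrier R"
  shows "span_set K (set Us) = Span K Us"
proof -
  have "Span K us \<subseteq> Span K Us" if "set us \<subseteq> set Us" for us
    by (rule mono_Span_subset[OF assms(1) _ assms(2)])
      (use that Span_base_incl[OF assms] in blast)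
  then show ?thesis
    unfolding span_set_def by blast
qed

end

end

theory Submission
  imports Defs
begin

text \<open>
  Let \<open>W = Sbar \<oplus> b E\<close> be the \<open>E\<close>-span of \<open>S\<close>, and for a nonzero scalar \<open>\<alpha>\<close> let
  \<open>dim (Sbar \<inter> \<alpha> Sbar) = d t\<close> and \<open>g = dim (S \<inter> \<alpha> S)\<close>, dimensions being over \<open>F\<close>. Since \<open>Sbar\<close> and
  \<open>\<alpha> Sbar\<close> are \<open>E\<close>-hyperplanes of \<open>W\<close> and \<open>\<alpha> W\<close>, the dimension of \<open>W \<inter> \<alpha> W\<close> is \<open>d t\<close>, \<open>(d + 1) t\<close> or
  \<open>(d + 2) t\<close>, and correspondingly \<open>g = d t\<close>, \<open>d t + max 0 (2 m - t) \<le> g \<le> d t + m\<close> or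
  \<open>g = d t + 2 m\<close>. A full weight spectrum code attains every \<open>g < l t + m\<close>. For \<open>t \<ge> 4\<close> some
  \<open>g < t\<close> is missed already. If \<open>m = 1\<close> and the stabilizer of \<open>W\<close> is larger than \<open>E\<close>, then
  \<open>g = (l - 1) t + 1\<close> would need \<open>dim (W \<inter> \<alpha> W) = l t\<close>; but both \<open>W\<close> and \<open>W \<inter> \<alpha> W\<close> are spaces over
  the stabilizer, whose degree over \<open>E\<close> cannot divide both \<open>l\<close> and \<open>l + 1\<close>. If \<open>(t, m) = (3, 1)\<close> and the
  stabilizer of \<open>W\<close> is \<open>E\<close>, then \<open>g = 3 l - 1\<close> forces \<open>\<alpha> W = W\<close>, hence \<open>\<alpha> \<in> E\<close> and
  \<open>\<alpha> Sbar = Sbar\<close>, which is not compatible with \<open>d = l - 1\<close>. If \<open>(t, m) = (3, 2)\<close>, then \<open>g = 3 l\<close>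
  forces the stabilizer of \<open>Sbar\<close> to be larger than \<open>E\<close>, and \<open>g = 3 l - 1\<close> then contradicts
  divisibility as before, for \<open>Sbar\<close> and \<open>Sbar \<inter> \<alpha> Sbar\<close>.
\<close>

context field
begin

section \<open>Cardinality and finite dimension of subspaces\<close>

lemma subfield_card_ge_2:
  assumes "subfield K R" "finite (carrier R)"
  shows "2 \<le> card K"
proof -
  have "{\<zero>, \<one>} \<subseteq> K" "finite K"
    using subringE(2,3)[OF subfieldE(1)[OF assms(1)]] subfieldE(3)[OF assms(1)] assms(2)
    by (auto intro: finite_subset)
  then have "card {\<zero>, \<one>} \<le> card K"
    by (intro card_mono)
  then show ?thesis
    by simp
qed

text \<open>The map \<open>(k, u) \<mapsto> k \<otimes> v \<oplus> u\<close> is injective: two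
  representations with distinct coefficients would, after division by \<open>k \<ominus> k'\<close>,
  put \<open>v\<close> into \<open>E\<close>.\<close>

lemma card_line_extension:
  assumes K: "subfield K R" and E: "subalgebra K E R" and v: "v \<in> carrier R" "v \<notin> E"
  shows "card (line_extension K v E) = card K * card E"
proof -
  let ?f = "\<lambda>(k, u). k \<otimes> v \<oplus> u"
  interpret E: subalgebra K E R by (fact E)
  note KR = subsetD[OF subfieldE(3)[OF K]]
  note ER = subsetD[OF subalgebra_in_carrier[OF E]]
  have "inj_on ?f (K \<times> E)"
  proof (rule inj_onI, clarify)
    fix k u k' u'
    assume *: "k \<in> K" "u \<in> E" "k' \<in> K" "u' \<in> E" "k \<otimes> v \<oplus> u = k' \<otimes> v \<oplus> u'"
    note c = KR[OF *(1)] ER[OF *(2)] KR[OF *(3)] ER[OF *(4)] v(1)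
    have eq: "(k \<ominus> k') \<otimes> v = u' \<ominus> u"
    proof -
      have "(k \<ominus> k') \<otimes> v = (k \<otimes> v \<oplus> u) \<ominus> k' \<otimes> v \<ominus> u"
        using c by algebra
      also have "\<dots> = u' \<ominus> u"
        unfolding *(5) using c by algebra
      finally show ?thesis .
    qed
    have kk: "k = k'"
    proof (rule ccontr)
      assume "k \<noteq> k'"
      then have ne: "k \<ominus> k' \<in> K - {\<zero>}"
        using * c subringE(5,7)[OF subfieldE(1)[OF K]] by (auto simp: a_minus_def)
           (metis a_minus_def r_right_minus_eq)
      note i = subfield_m_inv[OF K ne]
      have "u' \<ominus> u \<in> E"
        using * E.m_closed[of u' "\<ominus> u"] E.m_inv_closed[of u] by (simp add: a_minus_def a_inv_def)
      then have "inv (k \<ominus> k') \<otimes> ((k \<ominus> k') \<otimes> v) \<in> E"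
        unfolding eq using i(1) E.smult_closed by blast
      moreover have "inv (k \<ominus> k') \<otimes> ((k \<ominus> k') \<otimes> v) = v"
        using i KR ne v(1) by (metis DiffD1 l_one m_assoc)
      ultimately show False
        using v(2) by simp
    qed
    then show "k = k' \<and> u = u'"
      using *(5) c by simp
  qed
  moreover have "line_extension K v E = ?f ` (K \<times> E)"
    by (force simp: line_extension_mem_iff image_iff)
  ultimately show ?thesis
    by (simp add: card_image card_cartesian_product)
qed

lemma card_dimension:
  assumes K: "subfield K R" and "dimension n K E"
  shows "card E = card K ^ n"
  using assms(2,1)
proof (induction n K E rule: dimension.induct)
  case zero_dim
  then show ?case by simp
next
  case (Suc_dim v E n K)
  then have "subalgebra K E R"
    by (intro finite_dimension_imp_subalgebra finite_dimensionI)
  with Suc_dim show ?case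
    by (simp add: card_line_extension)
qed

text \<open>A finite subspace is generated by the list of all its elements.\<close>

lemma finite_dimension_subalgebra:
  assumes "finite (carrier R)" "subfield K R" "subalgebra K U R"
  shows "finite_dimension K U"
proof -
  note U = subalgebra_in_carrier[OF assms(3)]
  obtain us where us: "set us = U"
    using finite_list[OF finite_subset[OF U assms(1)]] by blast
  have "Span K us = U"
    using Span_base_incl[OF assms(2), of us] subalgebra_Span_incl[OF assms(2,3), of us] us U by blast
  then show ?thesis
    using Span_finite_dimension[OF assms(2), of us] us U by simp
qed

section \<open>Sums, scalings and stabilizers of subspaces\<close>

lemma subalgebra_set_add:
  assumes "K \<subseteq> carrier R" "subalgebra K U R" "subalgebra K V R"
  shows "subalgebra K (U <+>\<^bsub>R\<^esub> V) R"
proof -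
  interpret U: subalgebra K U R by fact
  interpret V: subalgebra K V R by fact
  have U: "U \<subseteq> carrier R" and V: "V \<subseteq> carrier R"
    using assms by (auto dest: subalgebra_in_carrier)
  show ?thesis
  proof (intro subalgebra.intro subalgebra_axioms.intro)
    show "subgroup (U <+>\<^bsub>R\<^esub> V) (add_monoid R)"
      using add.mult_subgroups[OF U.subgroup_axioms V.subgroup_axioms] by (simp add: set_add_def)
    fix k x assume k: "k \<in> K" and "x \<in> U <+>\<^bsub>R\<^esub> V"
    then obtain u v where uv: "u \<in> U" "v \<in> V" "x = u \<oplus> v"
      by (auto simp: set_add_def')
    then have "k \<otimes> x = k \<otimes> u \<oplus> k \<otimes> v"
      using k assms(1) U V by (auto intro!: r_distr)
    then show "k \<otimes> x \<in> U <+>\<^bsub>R\<^esub> V"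
      using U.smult_closed[OF k uv(1)] V.smult_closed[OF k uv(2)] by (auto simp: set_add_def')
  qed
qed

lemma subalgebra_l_coset:
  assumes K: "K \<subseteq> carrier R" "subalgebra K U R" and a: "a \<in> carrier R"
  shows "subalgebra K (a <# U) R"
proof -
  interpret U: subalgebra K U R by fact
  have U: "U \<subseteq> carrier R"
    using K by (auto dest: subalgebra_in_carrier)
  show ?thesis
  proof (intro subalgebra.intro subalgebra_axioms.intro add.subgroupI)
    show "a <# U \<subseteq> carrier R"
      using U a by (auto simp: l_coset_def)
    show "a <# U \<noteq> {}"
      using U.one_closed by (auto simp: l_coset_def)
    fix x assume x: "x \<in> a <# U"
    then obtain u where u: "u \<in> U" "x = a \<otimes> u"
      by (auto simp: l_coset_def)
    have "\<ominus> x = a \<otimes> (\<ominus> u)"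
      using u U a by (auto simp: r_minus)
    moreover have "\<ominus> u \<in> U"
      using u U.m_inv_closed[of u] by (simp add: a_inv_def)
    ultimately
    show "\<ominus> x \<in> a <# U"
      by (auto simp: l_coset_def)
    show "k \<otimes> x \<in> a <# U" if k: "k \<in> K" for k
    proof -
      have "k \<otimes> x = a \<otimes> (k \<otimes> u)"
        using u U a k K(1) m_lcomm[of k a u] by blast
      then show ?thesis
        using U.smult_closed[OF k u(1)] by (auto simp: l_coset_def)
    qed
    fix y assume "y \<in> a <# U"
    then obtain v where v: "v \<in> U" "y = a \<otimes> v"
      by (auto simp: l_coset_def)
    have "x \<oplus> y = a \<otimes> (u \<oplus> v)"
    proof -
      have "u \<in> carrier R" "v \<in> carrier R"
        using u v U by auto
      then show ?thesis
        using u(2) v(2) a by (simp add: r_distr)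
    qed
    moreover have "u \<oplus> v \<in> U"
      using U.m_closed u v by simp
    ultimately show "x \<oplus> y \<in> a <# U"
      by (auto simp: l_coset_def)
  qed
qed

lemma subalgebra_mono_field:
  "subalgebra E U R \<Longrightarrow> F \<subseteq> E \<Longrightarrow> subalgebra F U R"
  by (auto simp: subalgebra_def subalgebra_axioms_def)

lemma subfield_is_subalgebra:
  assumes "subfield E R" "F \<subseteq> E"
  shows "subalgebra F E R"
  using subringE(6)[OF subfieldE(1)[OF assms(1)]] subfieldE(1)[OF assms(1)] assms(2)
  by (auto simp: subalgebra_def subalgebra_axioms_def subring_def)

text \<open>Multiplication by a nonzero \<open>x\<close> is injective, so on the finite set
  \<open>U\<close> an inclusion of \<open>x <# U\<close> in \<open>U\<close> is already an equality.
  The criterion covers \<open>x = \<zero>\<close> as well, which makes the closure properties of the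
  stabilizer uniform.\<close>

lemma mem_stabilizer_iff:
  assumes U: "subgroup U (add_monoid R)" and fin: "finite (carrier R)" and x: "x \<in> carrier R"
  shows "x \<in> stabilizer U \<longleftrightarrow> (\<forall>u\<in>U. x \<otimes> u \<in> U)"
proof (cases "x = \<zero>")
  case True
  have "U \<subseteq> carrier R" "\<zero> \<in> U"
    using subgroup.subset[OF U] subgroup.one_closed[OF U] by auto
  then show ?thesis
    using True by (auto simp: stabilizer_def)
next
  case False
  have UR: "U \<subseteq> carrier R"
    using subgroup.subset[OF U] by simp
  have inj: "inj_on ((\<otimes>) x) U"
    using UR x False by (auto intro!: inj_onI simp: m_lcancel subset_iff)
  have im: "x <# U = (\<otimes>) x ` U"
    by (auto simp: l_coset_def)
  have "x <# U = U" if "\<forall>u\<in>U. x \<otimes> u \<in> U"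
    unfolding im using that endo_inj_surj[OF finite_subset[OF UR fin] _ inj] by blast
  then show ?thesis
    using False x im by (auto simp: stabilizer_def)
qed

text \<open>Sums, products and negatives follow from the inclusion criterion; for inverses the
  equality \<open>k <# U = U\<close> lets every element of \<open>U\<close> be divided by
  \<open>k\<close> within \<open>U\<close>.\<close>

lemma stabilizer_subfield:
  assumes U: "subgroup U (add_monoid R)" and fin: "finite (carrier R)"
  shows "subfield (stabilizer U) R"
proof -
  interpret U: subgroup U "add_monoid R" by fact
  have UR: "u \<in> carrier R" if "u \<in> U" for u
    using U.subset that by auto
  have sub: "stabilizer U \<subseteq> carrier R"
    by (auto simp: stabilizer_def)
  note iff = mem_stabilizer_iff[OF U fin]
  show ?thesis
  proof (intro subfieldI' subringI)
    show "stabilizer U \<subseteq> carrier R"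
      by (fact sub)
    show "\<one> \<in> stabilizer U"
      using UR by (simp add: iff)
  next
    fix h assume h: "h \<in> stabilizer U"
    then show "\<ominus> h \<in> stabilizer U"
      using sub UR iff U.m_inv_closed by (auto simp: l_minus subset_iff a_inv_def[symmetric])
    fix g assume g: "g \<in> stabilizer U"
    show "h \<otimes> g \<in> stabilizer U"
    proof -
      have "h \<in> carrier R" "g \<in> carrier R"
        using g h sub by auto
      then show ?thesis
        using g h UR by (simp add: iff m_assoc)
    qed
    show "h \<oplus> g \<in> stabilizer U"
    proof -
      have "h \<in> carrier R" "g \<in> carrier R"
        using g h sub by auto
      then show ?thesis
        using g h UR U.m_closed by (simp add: iff l_distr)
    qed
  next
    fix k assume k: "k \<in> stabilizer U - {\<zero>}"
    then have kc: "k \<in> carrier R" "k \<noteq> \<zero>" and eq: "k <# U = U"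
      by (auto simp: stabilizer_def)
    then have kU: "k \<in> Units R"
      by (simp add: field_Units)
    have "inv k \<otimes> u \<in> U" if u: "u \<in> U" for u
    proof -
      obtain w where "w \<in> U" "u = k \<otimes> w"
        using u eq by (auto simp: l_coset_def)
      then have "inv k \<otimes> u = w"
        using kU UR by (simp add: kc m_assoc[symmetric] Units_l_inv)
      then show ?thesis
        using \<open>w \<in> U\<close> by simp
    qed
    then show "inv k \<in> stabilizer U"
      using kU by (simp add: iff)
  qed
qed

lemma stabilizer_subalgebra:
  assumes U: "subgroup U (add_monoid R)" and fin: "finite (carrier R)"
  shows "subalgebra (stabilizer U) U R"
  using mem_stabilizer_iff[OF assms] subfieldE(3)[OF stabilizer_subfield[OF assms]] U
  by (auto simp: subalgebra_def subalgebra_axioms_def)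

lemma subalgebra_le_stabilizer:
  assumes "subalgebra E U R" "finite (carrier R)" "E \<subseteq> carrier R"
  shows "E \<subseteq> stabilizer U"
  using assms mem_stabilizer_iff[of U] by (auto simp: subalgebra_def subalgebra_axioms_def)


section \<open>Dimension counts in a finite field\<close>

text \<open>Since \<open>card K \<ge> 2\<close>, the dimension is determined by the cardinality;
  comparison of dimensions and their invariance under scaling thus reduce to counting
  elements.\<close>

lemma card_eq_power_dim:
  assumes "finite (carrier R)" "subfield K R" "subalgebra K U R"
  shows "card U = card K ^ (dim over K) U"
  using card_dimension[OF assms(2) finite_dimensionE[OF assms(2) finite_dimension_subalgebra[OF assms]]] .

lemma dim_eq_iff_card_eq:
  assumes "finite (carrier R)" "subfield K R" "subalgebra K U R" "subalgebra K V R"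
  shows "(dim over K) U = (dim over K) V \<longleftrightarrow> card U = card V"
  using subfield_card_ge_2[OF assms(2,1)] assms by (simp add: card_eq_power_dim)

lemma dim_mono:
  assumes "finite (carrier R)" "subfield K R" "subalgebra K U R" "subalgebra K V R" "U \<subseteq> V"
  shows "(dim over K) U \<le> (dim over K) V"
proof -
  have "card U \<le> card V"
    using assms by (meson card_mono finite_subset subalgebra_in_carrier)
  then show ?thesis
    using subfield_card_ge_2[OF assms(2,1)] assms by (simp add: card_eq_power_dim)
qed

lemma subalgebra_eqI_dim:
  assumes "finite (carrier R)" "subfield K R" "subalgebra K U R" "subalgebra K V R" "U \<subseteq> V"
    and "(dim over K) U = (dim over K) V"
  shows "U = V"
  using assms by (metis card_subset_eq dim_eq_iff_card_eq finite_subset subalgebra_in_carrier)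

lemma dim_add_dim_inter:
  assumes "finite (carrier R)" "subfield K R" "subalgebra K U R" "subalgebra K V R"
  shows "(dim over K) (U <+>\<^bsub>R\<^esub> V) + (dim over K) (U \<inter> V) = (dim over K) U + (dim over K) V"
  using sum_space_dim(2)[OF assms(2) finite_dimension_subalgebra[OF assms(1,2,3)]
      finite_dimension_subalgebra[OF assms(1,2,4)]]
    dim_mono[OF assms(1,2) subalgebra_inter[OF assms(3,4)] assms(3)]
  by simp

lemma dim_l_coset:
  assumes "finite (carrier R)" "subfield K R" "subalgebra K U R" "a \<in> carrier R - {\<zero>}"
  shows "(dim over K) (a <# U) = (dim over K) U"
proof -
  have U: "U \<subseteq> carrier R"
    using subalgebra_in_carrier[OF assms(3)] .
  have "inj_on ((\<otimes>) a) U"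
    using U assms(4) by (auto intro!: inj_onI simp: m_lcancel subset_iff)
  moreover have "a <# U = (\<otimes>) a ` U"
    by (auto simp: l_coset_def)
  ultimately have "card (a <# U) = card U"
    by (simp add: card_image)
  moreover have "subalgebra K (a <# U) R"
    using subalgebra_l_coset[OF subfieldE(3)[OF assms(2)]] assms(3,4) by simp
  ultimately show ?thesis
    using dim_eq_iff_card_eq assms by blast
qed

lemma dim_tower:
  assumes "finite (carrier R)" "subfield F R" "subfield E R" "F \<subseteq> E" "subalgebra E U R"
  shows "(dim over F) U = (dim over F) E * (dim over E) U"
  using telescopic_base_dim(2)[OF assms(2,3)] finite_dimension_subalgebra assms
    subfield_is_subalgebra by blast

lemma dim_pos:
  assumes "finite (carrier R)" "subfield F R" "subalgebra F U R" "x \<in> U" "x \<noteq> \<zero>"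
  shows "0 < (dim over F) U"
proof (rule ccontr)
  assume "\<not> 0 < (dim over F) U"
  then have "dimension 0 F U"
    using finite_dimensionE[OF assms(2) finite_dimension_subalgebra[OF assms(1-3)]] by simp
  then show False
    using dimension_zero[OF assms(2)] assms(4,5) by blast
qed

text \<open>The factor \<open>s\<close> is the degree of \<open>K\<close> over \<open>E\<close>. It
  is positive, and degree one would give \<open>E\<close> and \<open>K\<close> the same dimension
  over \<open>F\<close>, hence make them equal.\<close>

lemma dim_strict_extension:
  assumes fin: "finite (carrier R)" and F: "subfield F R" and E: "subfield E R" and K: "subfield K R"
    and sub: "F \<subseteq> E" "E \<subset> K"
  shows "\<exists>s\<ge>2. (dim over F) K = (dim over F) E * s"
proof -
  have EK: "subalgebra E K R" "subalgebra F K R" "subalgebra F E R"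
    using subfield_is_subalgebra K E sub by auto
  have "0 < (dim over E) K"
    using dim_pos[OF fin E EK(1), of \<one>] subringE(3)[OF subfieldE(1)[OF K]] by simp
  moreover have "(dim over F) K = (dim over F) E * (dim over E) K"
    using dim_tower[OF fin F E sub(1) EK(1)] .
  moreover have "(dim over F) E \<noteq> (dim over F) K"
    using subalgebra_eqI_dim[OF fin F EK(3,2)] sub by blast
  ultimately show ?thesis
    by (intro exI[of _ "(dim over E) K"]) (cases "(dim over E) K = 1"; simp)
qed

section \<open>Hyperplanes and intersections of nested pairs\<close>

lemma subalgebra_set_add_upper:
  assumes "subalgebra K U R" "subalgebra K V R"
  shows "U \<subseteq> U <+>\<^bsub>R\<^esub> V" "V \<subseteq> U <+>\<^bsub>R\<^esub> V"
proof -
  interpret U: subalgebra K U R by fact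
  interpret V: subalgebra K V R by fact
  show "U \<subseteq> U <+>\<^bsub>R\<^esub> V" "V \<subseteq> U <+>\<^bsub>R\<^esub> V"
    using U.one_closed V.one_closed U.subset V.subset
    by (force simp: set_add_def' intro: r_zero[symmetric] l_zero[symmetric])+
qed

lemma subalgebra_set_add_least:
  assumes "subalgebra K W R" "U \<subseteq> W" "V \<subseteq> W"
  shows "U <+>\<^bsub>R\<^esub> V \<subseteq> W"
proof -
  interpret W: subalgebra K W R by fact
  show ?thesis
    using W.m_closed assms(2,3) by (auto simp: set_add_def')
qed

text \<open>\<open>H\<close> is an \<open>E\<close>-hyperplane of \<open>W\<close>, so adding an
  \<open>E\<close>-space \<open>Z\<close> not inside \<open>H\<close> fills \<open>W\<close>. The
  same then holds for every \<open>S\<close> between \<open>H\<close> and \<open>W\<close>, even if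
  \<open>S\<close> is only an \<open>F\<close>-space, and the dimension formula gives the
  intersection.\<close>

lemma dim_inter_hyperplane:
  assumes fin: "finite (carrier R)" and F: "subfield F R" and E: "subfield E R" and FE: "F \<subseteq> E"
    and H: "subalgebra E H R" and W: "subalgebra E W R" and Z: "subalgebra E Z R"
    and S: "subalgebra F S R"
    and sub: "H \<subseteq> S" "S \<subseteq> W" "Z \<subseteq> W" "\<not> Z \<subseteq> H"
    and dim: "(dim over F) W = (dim over F) H + (dim over F) E"
  shows "S <+>\<^bsub>R\<^esub> Z = W"
    and "(dim over F) (Z \<inter> S) + (dim over F) W = (dim over F) Z + (dim over F) S"
proof -
  let ?d = "dim over F"
  note FR = subfieldE(3)[OF F] and ER = subfieldE(3)[OF E]
  have HZ: "subalgebra E (H <+>\<^bsub>R\<^esub> Z) R"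
    using subalgebra_set_add[OF ER H Z] .
  note F_sub = subalgebra_mono_field[OF _ FE]
  have HZW: "H <+>\<^bsub>R\<^esub> Z \<subseteq> W"
    using subalgebra_set_add_least[OF W] sub by blast
  have "H \<noteq> H <+>\<^bsub>R\<^esub> Z"
    using subalgebra_set_add_upper(2)[OF H Z] sub(4) by blast
  then have "?d H \<noteq> ?d (H <+>\<^bsub>R\<^esub> Z)"
    using subalgebra_eqI_dim[OF fin F F_sub[OF H] F_sub[OF HZ]] subalgebra_set_add_upper(1)[OF H Z]
    by blast
  then have lt: "?d H < ?d (H <+>\<^bsub>R\<^esub> Z)"
    using dim_mono[OF fin F F_sub[OF H] F_sub[OF HZ]] subalgebra_set_add_upper(1)[OF H Z] by simp
  \<comment> \<open>Both dimensions are multiples of \<open>?d E\<close>, so a strict increase is at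
    least one full step.\<close>
  have "?d H + ?d E \<le> ?d (H <+>\<^bsub>R\<^esub> Z)"
  proof -
    obtain i j where ij: "?d H = ?d E * i" "?d (H <+>\<^bsub>R\<^esub> Z) = ?d E * j"
      using dim_tower[OF fin F E FE H] dim_tower[OF fin F E FE HZ] by blast
    then have "i < j"
      using lt by simp
    then have "?d E * Suc i \<le> ?d E * j"
      by (intro mult_le_mono2) simp
    then show ?thesis
      using ij by simp
  qed
  then have "H <+>\<^bsub>R\<^esub> Z = W"
    using dim subalgebra_eqI_dim[OF fin F F_sub[OF HZ] F_sub[OF W] HZW]
      dim_mono[OF fin F F_sub[OF HZ] F_sub[OF W] HZW] by simp
  moreover have "H <+>\<^bsub>R\<^esub> Z \<subseteq> S <+>\<^bsub>R\<^esub> Z"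
    using sub(1) by (auto simp: set_add_def')
  moreover have "S <+>\<^bsub>R\<^esub> Z \<subseteq> W"
    using subalgebra_set_add_least[OF W] sub by blast
  ultimately show *: "S <+>\<^bsub>R\<^esub> Z = W"
    by blast
  show "?d (Z \<inter> S) + ?d W = ?d Z + ?d S"
    using dim_add_dim_inter[OF fin F S F_sub[OF Z]] unfolding * by (simp add: Int_commute)
qed

text \<open>The cases reflect the position of \<open>Z = W \<inter> W'\<close>: inside both
  \<open>H\<close> and \<open>H'\<close>; inside exactly one of them, or meeting both in one common
  hyperplane; meeting them in two distinct hyperplanes. Only the common hyperplane leaves the
  dimension of \<open>S \<inter> S'\<close> undetermined. The truncated \<open>2 * m - t\<close>
  expresses the bound \<open>max 0 (2 m - t)\<close>.\<close>

lemma intersection_cases: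
  assumes fin: "finite (carrier R)" and F: "subfield F R" and E: "subfield E R" and FE: "F \<subseteq> E"
    and H: "subalgebra E H R" "subalgebra E H' R"
    and W: "subalgebra E W R" "subalgebra E W' R"
    and S: "subalgebra F S R" "subalgebra F S' R"
    and sub: "H \<subseteq> S" "S \<subseteq> W" "H' \<subseteq> S'" "S' \<subseteq> W'"
    and dims: "(dim over F) E = t"
      "(dim over F) W = (dim over F) H + t" "(dim over F) W' = (dim over F) H' + t"
      "(dim over F) S = (dim over F) H + m" "(dim over F) S' = (dim over F) H' + m"
  obtains d where "(dim over F) (H \<inter> H') = d * t" "(dim over F) (W \<inter> W') = d * t"
      "(dim over F) (S \<inter> S') = d * t"
  | d where "(dim over F) (H \<inter> H') = d * t" "(dim over F) (W \<inter> W') = (d + 1) * t"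
      "d * t + (2 * m - t) \<le> (dim over F) (S \<inter> S')" "(dim over F) (S \<inter> S') \<le> d * t + m"
  | d where "(dim over F) (H \<inter> H') = d * t" "(dim over F) (W \<inter> W') = (d + 2) * t"
      "(dim over F) (S \<inter> S') = d * t + 2 * m"
proof -
  let ?d = "dim over F"
  define Z where "Z = W \<inter> W'"
  note F_sub = subalgebra_mono_field[OF _ FE]
  have Z: "subalgebra E Z R"
    unfolding Z_def using subalgebra_inter W by blast
  have ZW: "Z \<subseteq> W" "Z \<subseteq> W'" and HZ: "H \<inter> H' \<subseteq> Z"
    using sub by (auto simp: Z_def)
  have SZ: "S \<inter> S' = (Z \<inter> S) \<inter> (Z \<inter> S')" and HHZ: "H \<inter> H' = (Z \<inter> H) \<inter> (Z \<inter> H')"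
    using sub by (auto simp: Z_def)
  have ZS: "subalgebra F (Z \<inter> S) R" "subalgebra F (Z \<inter> S') R" "subalgebra F (S \<inter> S') R"
    and ZH: "subalgebra E (Z \<inter> H) R" "subalgebra E (Z \<inter> H') R"
    using subalgebra_inter Z S H F_sub by blast+
  obtain d where d: "?d (H \<inter> H') = d * t"
    using dim_tower[OF fin F E FE subalgebra_inter[OF H]] dims(1) by (metis mult.commute)
  have HS: "H \<subseteq> W" "H' \<subseteq> W'"
    using sub by auto
  have hyp1: "?d (Z \<inter> H) + t = ?d Z" "?d (Z \<inter> S) + t = ?d Z + m" if "\<not> Z \<subseteq> H"
    using dim_inter_hyperplane(2)[OF fin F E FE H(1) W(1) Z F_sub[OF H(1)] order_refl HS(1) ZW(1) that]
      dim_inter_hyperplane(2)[OF fin F E FE H(1) W(1) Z S(1) sub(1,2) ZW(1) that] dims by auto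
  have hyp2: "?d (Z \<inter> H') + t = ?d Z" "?d (Z \<inter> S') + t = ?d Z + m" if "\<not> Z \<subseteq> H'"
    using dim_inter_hyperplane(2)[OF fin F E FE H(2) W(2) Z F_sub[OF H(2)] order_refl HS(2) ZW(2) that]
      dim_inter_hyperplane(2)[OF fin F E FE H(2) W(2) Z S(2) sub(3,4) ZW(2) that] dims by auto
  \<comment> \<open>This makes the exact value \<open>d * t + m\<close> of the second and third case
    below satisfy the lower bound \<open>d * t + (2 * m - t)\<close>.\<close>
  have mt: "m \<le> t"
    using dim_mono[OF fin F S(1) F_sub[OF W(1)] sub(2)] dims by simp
  consider "Z \<subseteq> H" "Z \<subseteq> H'" | "Z \<subseteq> H" "\<not> Z \<subseteq> H'" | "\<not> Z \<subseteq> H" "Z \<subseteq> H'"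
    | "\<not> Z \<subseteq> H" "\<not> Z \<subseteq> H'" "Z \<inter> H = Z \<inter> H'" | "\<not> Z \<subseteq> H" "\<not> Z \<subseteq> H'" "Z \<inter> H \<noteq> Z \<inter> H'"
    by blast
  then show thesis
  proof cases
    case 1
    then have "H \<inter> H' = Z" "S \<inter> S' = Z"
      using HZ sub by (auto simp: Z_def)
    then show thesis
      using that(1)[of d] d by (simp add: Z_def)
  next
    case 2
    then have "H \<inter> H' = Z \<inter> H'" "S \<inter> S' = Z \<inter> S'"
      using HHZ SZ sub by auto
    then show thesis
      using that(2)[of d] hyp2[OF 2(2)] d mt by (auto simp: Z_def)
  next
    case 3
    then have "H \<inter> H' = Z \<inter> H" "S \<inter> S' = Z \<inter> S"
      using HHZ SZ sub by auto
    then show thesis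
      using that(2)[of d] hyp1[OF 3(1)] d mt by (auto simp: Z_def)
  next
    case 4
    then have HH: "H \<inter> H' = Z \<inter> H"
      using HHZ by auto
    \<comment> \<open>Two subspaces of dimension \<open>d * t + m\<close> inside the space
      \<open>Z\<close> of dimension \<open>(d + 1) * t\<close> overlap in dimension at least
      \<open>d * t + 2 m - t\<close>.\<close>
    have "(Z \<inter> S) <+>\<^bsub>R\<^esub> (Z \<inter> S') \<subseteq> Z"
      using subalgebra_set_add_least[OF Z] by blast
    then have "?d ((Z \<inter> S) <+>\<^bsub>R\<^esub> (Z \<inter> S')) \<le> ?d Z"
      using dim_mono[OF fin F subalgebra_set_add[OF subfieldE(3)[OF F] ZS(1,2)] F_sub[OF Z]] by blast
    then have "?d (Z \<inter> S) + ?d (Z \<inter> S') \<le> ?d Z + ?d (S \<inter> S')"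
      using dim_add_dim_inter[OF fin F ZS(1,2)] SZ by simp
    moreover have "?d (S \<inter> S') \<le> ?d (Z \<inter> S)"
      using dim_mono[OF fin F ZS(3,1)] SZ by blast
    moreover have "?d (H \<inter> H') \<le> ?d (S \<inter> S')"
      using dim_mono[OF fin F F_sub[OF subalgebra_inter[OF H]] ZS(3)] sub by blast
    ultimately show thesis
      using that(2)[of d] hyp1[OF 4(1)] hyp2[OF 4(2)] d HH by (auto simp: Z_def)
  next
    case 5
    \<comment> \<open>Distinct subspaces of equal dimension are not nested. The hyperplane lemma can
      therefore be applied inside \<open>Z\<close>, with \<open>Z \<inter> H\<close> as the
      hyperplane and \<open>Z \<inter> H'\<close> as the space added to it.\<close>
    have "\<not> Z \<inter> H' \<subseteq> Z \<inter> H"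
      using subalgebra_eqI_dim[OF fin F F_sub[OF ZH(2)] F_sub[OF ZH(1)]] 5(3)
        hyp1(1)[OF 5(1)] hyp2(1)[OF 5(2)] by auto
    note hyp = dim_inter_hyperplane[OF fin F E FE ZH(1) Z ZH(2) _ _ _ _ this, of "Z \<inter> H"]
      dim_inter_hyperplane[OF fin F E FE ZH(1) Z ZH(2) ZS(1) _ _ _ this]
    have "?d (H \<inter> H') + t = ?d (Z \<inter> H')"
      using hyp(2) F_sub[OF ZH(1)] hyp1(1)[OF 5(1)] dims(1) HHZ by (simp add: Int_commute)
    moreover have "(Z \<inter> S) <+>\<^bsub>R\<^esub> (Z \<inter> S') = Z"
    proof
      show "(Z \<inter> S) <+>\<^bsub>R\<^esub> (Z \<inter> S') \<subseteq> Z"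
        using subalgebra_set_add_least[OF Z] by blast
      have "Z = (Z \<inter> S) <+>\<^bsub>R\<^esub> (Z \<inter> H')"
        using hyp(3) hyp1(1)[OF 5(1)] dims(1) sub by auto
      also have "\<dots> \<subseteq> (Z \<inter> S) <+>\<^bsub>R\<^esub> (Z \<inter> S')"
        using sub(3) unfolding set_add_def' by blast
      finally show "Z \<subseteq> (Z \<inter> S) <+>\<^bsub>R\<^esub> (Z \<inter> S')" .
    qed
    then have "?d Z + ?d (S \<inter> S') = ?d (Z \<inter> S) + ?d (Z \<inter> S')"
      using dim_add_dim_inter[OF fin F ZS(1,2)] SZ by simp
    ultimately show thesis
      using that(3)[of d] hyp1[OF 5(1)] hyp2[OF 5(2)] d by (auto simp: Z_def)
  qed
qed

section \<open>Attained dimensions, powers of \<open>lam\<close> and divisibility\<close>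

text \<open>Distance \<open>2 i\<close> means an intersection of dimension \<open>k - i\<close>,
  with \<open>k\<close> the dimension of \<open>S\<close>; the range
  \<open>1 \<le> i \<le> k\<close> becomes \<open>0 \<le> j < k\<close>.\<close>

lemma full_weight_spectrumD:
  assumes fin: "finite (carrier R)" and F: "subfield F R" and S: "subalgebra F S R"
    and fws: "full_weight_spectrum F S" and j: "j < (dim over F) S"
  obtains a where "a \<in> carrier R - {\<zero>}" "(dim over F) (S \<inter> (a <# S)) = j"
proof -
  let ?k = "(dim over F) S"
  have "?k - j \<in> {1..?k}"
    using j by auto
  then have "weight F S (?k - j) > 0"
    using fws unfolding full_weight_spectrum_def by blast
  then obtain V where "V \<in> Orb S" "subspace_dist F S V = 2 * int (?k - j)"
    unfolding weight_def by (auto simp: card_gt_0_iff)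
  then show thesis
    using that j by (auto simp: Orb_def subspace_dist_def)
qed

text \<open>If \<open>lam [^] m\<close> were in the span \<open>U\<close> of the lower powers,
  \<open>U\<close> would be closed under multiplication by \<open>lam\<close>, so its stabilizer
  would contain the field generated by \<open>lam\<close> over \<open>F\<close>. As \<open>U\<close>
  contains \<open>\<one>\<close>, it would contain that field, whose dimension exceeds
  \<open>m\<close>.\<close>

lemma dim_Span_powers:
  assumes fin: "finite (carrier R)" and F: "subfield F R" and lam: "lam \<in> carrier R"
    and m: "m \<le> (dim over F) (generate_field R (insert lam F))"
  shows "(dim over F) (Span F (map (\<lambda>i. lam [^] i) [0..<m])) = m"
proof -
  let ?E = "generate_field R (insert lam F)"
  let ?p = "\<lambda>m. map (\<lambda>i. lam [^] i) [0..<m::nat]"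
  have FR: "insert lam F \<subseteq> carrier R"
    using subfieldE(3)[OF F] lam by simp
  have E: "subfield ?E R" "insert lam F \<subseteq> ?E"
    using generate_fieldE[OF FR refl] by auto
  have pR: "set (?p m) \<subseteq> carrier R" for m
    using lam by auto
  \<comment> \<open>The list is reversed so that the induction adds the new power at the head, as
    \<open>li_Cons\<close> requires.\<close>
  have "independent F (rev (?p m))"
    using m
  proof (induction m)
    case 0
    then show ?case by simp
  next
    case (Suc m)
    define U where "U = Span F (?p m)"
    have U: "subalgebra F U R"
      unfolding U_def by (rule Span_is_subalgebra[OF F pR])
    interpret U: subalgebra F U R by (fact U)
    have "lam [^] m \<notin> U"
    proof
      assume "lam [^] m \<in> U"
      moreover have "lam [^] i \<in> U" if "i < m" for i
        using Span_base_incl[OF F pR, of m] that by (auto simp: U_def)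
      ultimately have pow: "lam [^] i \<in> U" if "i \<le> m" for i
        using that by (cases "i = m") auto
      \<comment> \<open>A subspace that contains all generators of \<open>U\<close>, hence all of
        \<open>U\<close>; this is the closure of \<open>U\<close> under \<open>lam\<close>.\<close>
      define V where "V = {u \<in> U. lam \<otimes> u \<in> U}"
      have UR: "u \<in> carrier R" if "u \<in> U" for u
        using that U.subset by auto
      have "subalgebra F V R"
      proof (intro subalgebra.intro subalgebra_axioms.intro add.subgroupI)
        have "\<zero> \<in> V"
          using U.one_closed lam by (simp add: V_def)
        then show "V \<subseteq> carrier R" "V \<noteq> {}"
          using UR by (auto simp: V_def)
        fix x assume x: "x \<in> V"
        have "\<ominus> u \<in> U" if "u \<in> U" for u
          using U.m_inv_closed[OF that] by (simp add: a_inv_def)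
        then show "\<ominus> x \<in> V"
          using x UR lam r_minus[of lam x] by (simp add: V_def)
        show "k \<otimes> x \<in> V" if "k \<in> F" for k
        proof -
          have x': "x \<in> U" "lam \<otimes> x \<in> U"
            using x by (auto simp: V_def)
          moreover have "lam \<otimes> (k \<otimes> x) = k \<otimes> (lam \<otimes> x)"
            using m_lcomm[of lam k x] that UR[OF x'(1)] lam FR by blast
          ultimately show ?thesis
            using U.smult_closed[OF that] by (simp add: V_def)
        qed
        fix y assume "y \<in> V"
        then show "x \<oplus> y \<in> V"
          using x U.m_closed UR lam r_distr[of x y lam] by (simp add: V_def)
      qed
      moreover have "set (?p m) \<subseteq> V"
      proof
        fix x assume "x \<in> set (?p m)"
        then obtain i where i: "i < m" "x = lam [^] i"
          by auto
        then have "lam \<otimes> x = lam [^] Suc i"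
          using lam by (simp add: m_comm)
        then show "x \<in> V"
          using pow[of i] pow[of "Suc i"] i by (simp add: V_def)
      qed
      ultimately have "U \<subseteq> V"
        unfolding U_def by (rule subalgebra_Span_incl[OF F])
      then have "lam \<in> stabilizer U"
        using mem_stabilizer_iff[OF U.subgroup_axioms fin lam] by (auto simp: V_def)
      moreover have "F \<subseteq> stabilizer U"
        using subalgebra_le_stabilizer[OF U fin] FR by simp
      ultimately have "?E \<subseteq> stabilizer U"
        using generate_field_min_subfield1[OF FR stabilizer_subfield[OF U.subgroup_axioms fin]] by simp
      have "?E \<subseteq> U"
      proof
        fix e assume e: "e \<in> ?E"
        then have eR: "e \<in> carrier R" and "e \<in> stabilizer U"
          using \<open>?E \<subseteq> stabilizer U\<close> subfieldE(3)[OF E(1)] by blast+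
        moreover have "\<one> \<in> U"
          using pow[of 0] by simp
        ultimately have "e \<otimes> \<one> \<in> U"
          using mem_stabilizer_iff[OF U.subgroup_axioms fin] by blast
        then show "e \<in> U"
          using eR by simp
      qed
      then have "(dim over F) ?E \<le> (dim over F) U"
        using dim_mono[OF fin F subfield_is_subalgebra[OF E(1)] U] E(2) by simp
      moreover have "(dim over F) U = m"
        using dimI[OF F dimension_independent[OF Suc.IH]] Suc.prems Span_same_set[OF F pR, of m "rev (?p m)"]
        by (simp add: U_def del: Span.simps)
      ultimately show False
        using Suc.prems by simp
    qed
    moreover have "U = Span F (rev (?p m))"
      using Span_same_set[OF F pR, of m "rev (?p m)"] by (simp add: U_def del: Span.simps)
    ultimately have "lam [^] m \<notin> Span F (rev (?p m))"
      by simp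
    then have "independent F (lam [^] m # rev (?p m))"
      using Suc lam by (intro li_Cons) auto
    then show ?case
      by simp
  qed
  then have "(dim over F) (Span F (rev (?p m))) = m"
    using dimI[OF F dimension_independent, of "rev (?p m)"] by (simp del: Span.simps)
  then show ?thesis
    using Span_same_set[OF F pR, of m "rev (?p m)"] by (simp del: Span.simps)
qed

lemma inter_l_coset_full_dim:
  assumes fin: "finite (carrier R)" and F: "subfield F R" and U: "subalgebra F U R"
    and a: "a \<in> carrier R - {\<zero>}"
  shows "(dim over F) (U \<inter> (a <# U)) = (dim over F) U \<longleftrightarrow> a \<in> stabilizer U"
proof -
  have aU: "subalgebra F (a <# U) R"
    using subalgebra_l_coset[OF subfieldE(3)[OF F] U] a by simp
  have *: "a \<in> stabilizer U \<longleftrightarrow> a <# U = U"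
    using a by (auto simp: stabilizer_def)
  have "a <# U = U" if "(dim over F) (U \<inter> (a <# U)) = (dim over F) U"
  proof -
    have "U \<inter> (a <# U) = U"
      using subalgebra_eqI_dim[OF fin F subalgebra_inter[OF U aU] U _ that] by blast
    then show ?thesis
      using subalgebra_eqI_dim[OF fin F U aU] dim_l_coset[OF fin F U a] by auto
  qed
  then show ?thesis
    unfolding * by auto
qed

text \<open>With \<open>s \<ge> 2\<close> the degree of \<open>K\<close> over \<open>E\<close>, the
  \<open>E\<close>-dimension of every \<open>K\<close>-space is a multiple of \<open>s\<close>, but
  \<open>s\<close> cannot divide both \<open>i\<close> and \<open>i + 1\<close>.\<close>

lemma strict_extension_no_consecutive_dims:
  assumes fin: "finite (carrier R)" and F: "subfield F R" and E: "subfield E R" and K: "subfield K R"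
    and sub: "F \<subseteq> E" "E \<subset> K"
    and U: "subalgebra K U R" "(dim over F) U = (i + 1) * (dim over F) E"
    and V: "subalgebra K V R" "(dim over F) V = i * (dim over F) E"
  shows False
proof -
  obtain s where s: "2 \<le> s" "(dim over F) K = (dim over F) E * s"
    using dim_strict_extension[OF fin F E K sub] by blast
  have FK: "F \<subseteq> K"
    using sub by blast
  have t: "0 < (dim over F) E"
    using dim_pos[OF fin F subfield_is_subalgebra[OF E sub(1)], of \<one>]
      subringE(3)[OF subfieldE(1)[OF E]] by simp
  have "(i + 1) * (dim over F) E = (dim over F) E * s * (dim over K) U"
    using dim_tower[OF fin F K FK U(1)] U(2) s(2) by simp
  then have "i + 1 = s * (dim over K) U"
    using t by (simp add: mult.assoc mult.commute[of "i + 1"] del: mult_Suc_right mult_Suc)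
  moreover have "i * (dim over F) E = (dim over F) E * s * (dim over K) V"
    using dim_tower[OF fin F K FK V(1)] V(2) s(2) by simp
  then have "i = s * (dim over K) V"
    using t by (simp add: mult.assoc mult.commute[of i])
  ultimately have "s dvd i + 1" "s dvd i"
    by (metis dvd_triv_left)+
  then have "s dvd 1"
    using dvd_add_right_iff by blast
  then show False
    using s(1) by simp
qed

section \<open>Exclusion of a full weight spectrum by cases on \<open>t\<close> and
  \<open>m\<close>\<close>

text \<open>Here \<open>H\<close> stands for \<open>Sbar\<close> and \<open>W\<close> for the
  \<open>E\<close>-span of \<open>S\<close>. The powers of \<open>lam\<close> enter only through the
  dimension of \<open>S\<close>.\<close>

lemma not_full_weight_spectrum:
  assumes fin: "finite (carrier R)" and F: "subfield F R" and E: "subfield E R" and FE: "F \<subseteq> E"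
    and H: "subalgebra E H R" and W: "subalgebra E W R" and S: "subalgebra F S R"
    and sub: "H \<subseteq> S" "S \<subseteq> W"
    and dims: "(dim over F) E = t" "(dim over F) H = l * t" "(dim over F) W = (l + 1) * t"
      "(dim over F) S = l * t + m"
    and pos: "0 < l" "0 < m" "m < t"
    and cond: "(t, m) \<noteq> (2, 1) \<or> E \<subset> stabilizer W"
  shows "\<not> full_weight_spectrum F S"
proof
  assume fws: "full_weight_spectrum F S"
  note F_sub = subalgebra_mono_field[OF _ FE]
  note ER = subfieldE(3)[OF E] and FR = subfieldE(3)[OF F]
  have attained: "\<exists>a d. a \<in> carrier R - {\<zero>} \<and> (dim over F) (H \<inter> (a <# H)) = d * t \<and>
      ((dim over F) (W \<inter> (a <# W)) = d * t \<and> j = d * t \<or>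
       (dim over F) (W \<inter> (a <# W)) = (d + 1) * t \<and> d * t + (2 * m - t) \<le> j \<and> j \<le> d * t + m \<or>
       (dim over F) (W \<inter> (a <# W)) = (d + 2) * t \<and> j = d * t + 2 * m)"
    if j: "j < l * t + m" for j
  proof -
    obtain a where a: "a \<in> carrier R - {\<zero>}" "(dim over F) (S \<inter> (a <# S)) = j"
      by (rule full_weight_spectrumD[OF fin F S fws, of j]) (use j dims(4) in auto)
    have aR: "a \<in> carrier R"
      using a by simp
    note dim_a = dim_l_coset[OF fin F _ a(1)]
    have mono: "a <# A \<subseteq> a <# B" if "A \<subseteq> B" for A B
      using that by (auto simp: l_coset_def)
    have eqs: "(dim over F) W = (dim over F) H + t"
      "(dim over F) (a <# W) = (dim over F) (a <# H) + t"
      "(dim over F) S = (dim over F) H + m" "(dim over F) (a <# S) = (dim over F) (a <# H) + m"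
      using dim_a[OF F_sub[OF H]] dim_a[OF F_sub[OF W]] dim_a[OF S] dims by simp_all
    show ?thesis
    proof (cases rule: intersection_cases[OF fin F E FE H subalgebra_l_coset[OF ER H aR]
            W subalgebra_l_coset[OF ER W aR] S subalgebra_l_coset[OF FR S aR]
            sub mono[OF sub(1)] mono[OF sub(2)] dims(1) eqs])
      case (1 d)
      then show ?thesis
        using a by blast
    next
      case (2 d)
      then show ?thesis
        using a by blast
    next
      case (3 d)
      then show ?thesis
        using a by blast
    qed
  qed
  obtain l' where l': "l = Suc l'"
    using pos(1) by (cases l) auto
  have HR: "subgroup H (add_monoid R)" and WR: "subgroup W (add_monoid R)"
    using H W by (auto simp: subalgebra_def)
  note KH = stabilizer_subfield[OF HR fin] and KW = stabilizer_subfield[OF WR fin]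
  have "4 \<le> t \<or> (t = 3 \<and> m = 2) \<or> (t = 3 \<and> m = 1) \<or> (t = 2 \<and> m = 1)"
    using pos by auto
  then consider "4 \<le> t" | "m = 1" "E \<subset> stabilizer W"
    | "t = 3" "m = 1" "\<not> E \<subset> stabilizer W" | "t = 3" "m = 2"
    using cond by auto
  then show False
  proof cases
    case 1
    \<comment> \<open>A value below \<open>t\<close> forces \<open>d = 0\<close>.\<close>
    have small: "j = 0 \<or> 2 * m - t \<le> j \<and> j \<le> m \<or> j = 2 * m" if j: "j < t" for j
    proof -
      have "j < l * t + m"
        using j l' by simp
      then obtain d where d: "j = d * t \<or> d * t + (2 * m - t) \<le> j \<and> j \<le> d * t + m \<or> j = d * t + 2 * m"
        using attained by blast
      then have "d = 0"
        using j by (cases d) auto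
      then show ?thesis
        using d by auto
    qed
    show False
    \<comment> \<open>If \<open>m = t - 1\<close>, the interval starts at
      \<open>t - 2 \<ge> 2\<close> and the value 1 is missed. Otherwise \<open>m + 1 < t\<close> is
      attained only as \<open>2 * m\<close>, so \<open>m = 1\<close>, and then 3 is missed.\<close>
    proof (cases "m = t - 1")
      case True
      then show False
        using small[of 1] 1 by linarith
    next
      case False
      then show False
        using small[of "m + 1"] small[of 3] 1 pos by linarith
    qed
  next
    case 2
    have "l' * t + 1 < l * t + m"
      using pos l' by simp
    then obtain a d where a: "a \<in> carrier R - {\<zero>}" and
      d: "(dim over F) (W \<inter> (a <# W)) = d * t \<and> l' * t + 1 = d * t \<or>
        (dim over F) (W \<inter> (a <# W)) = (d + 1) * t \<and> d * t \<le> l' * t + 1 \<and> l' * t + 1 \<le> d * t + 1 \<or>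
        l' * t + 1 = d * t + 2"
      using attained[of "l' * t + 1"] 2(1) by fastforce
    \<comment> \<open>As \<open>t \<ge> 2\<close>, this rules out the first and third alternatives,
      and in the second it leaves only \<open>d = l'\<close>.\<close>
    have no: "x * t + 1 \<noteq> y * t" for x y
    proof
      assume "x * t + 1 = y * t"
      then have "t dvd x * t + 1"
        by (metis dvd_triv_right)
      then show False
        using pos by (simp only: dvd_add_right_iff dvd_triv_right) simp
    qed
    have "l' * t = d * t"
      using d no[of l' d] no[of d l'] by linarith
    then have "d = l'" "(dim over F) (W \<inter> (a <# W)) = (l' + 1) * t"
      using d pos no[of l' d] by auto
    then show False
      using strict_extension_no_consecutive_dims[OF fin F E KW FE 2(2)
          stabilizer_subalgebra[OF WR fin] _
          subalgebra_inter[OF stabilizer_subalgebra[OF WR fin]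
            subalgebra_l_coset[OF subfieldE(3)[OF KW] stabilizer_subalgebra[OF WR fin]]], of l a] a dims l'
      by simp
  next
    case 3
    then have EW: "E = stabilizer W"
      using subalgebra_le_stabilizer[OF W fin ER] by blast
    have "3 * l' + 2 < l * t + m"
      using l' 3 by simp
    then obtain a d where a: "a \<in> carrier R - {\<zero>}" and
      d: "(dim over F) (H \<inter> (a <# H)) = d * t"
      "(dim over F) (W \<inter> (a <# W)) = d * t \<and> 3 * l' + 2 = d * t \<or>
       (dim over F) (W \<inter> (a <# W)) = (d + 1) * t \<and> d * t + (2 * m - t) \<le> 3 * l' + 2 \<and> 3 * l' + 2 \<le> d * t + m \<or>
       (dim over F) (W \<inter> (a <# W)) = (d + 2) * t \<and> 3 * l' + 2 = d * t + 2 * m"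
      using attained by blast
    then have d: "(dim over F) (H \<inter> (a <# H)) = d * 3" "(dim over F) (W \<inter> (a <# W)) = (d + 2) * 3" "d = l'"
    proof -
      \<comment> \<open>Modulo 3, the value \<open>3 * l' + 2\<close> fits only the alternative
        \<open>d * 3 + 2\<close>. There \<open>W \<inter> (a <# W)\<close> has dimension
        \<open>(l' + 2) * 3\<close>, which is that of \<open>W\<close>.\<close>
      have "3 * l' + 2 \<noteq> d * 3" "\<not> (d * 3 \<le> 3 * l' + 2 \<and> 3 * l' + 2 \<le> d * 3 + 1)"
        by presburger+
      then show "(dim over F) (H \<inter> (a <# H)) = d * 3" "(dim over F) (W \<inter> (a <# W)) = (d + 2) * 3"
        "d = l'"
        using d 3(1,2) by auto
    qed
    then have "a \<in> stabilizer W"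
      using inter_l_coset_full_dim[OF fin F F_sub[OF W] a] dims 3 l' by simp
    then have "a \<in> stabilizer H"
      using EW subalgebra_le_stabilizer[OF H fin ER] by blast
    then show False
      using inter_l_coset_full_dim[OF fin F F_sub[OF H] a] d dims 3 l' by simp
  next
    case 4
    have "3 * l < l * t + m"
      using 4 by simp
    then obtain a d where a: "a \<in> carrier R - {\<zero>}" and
      d: "(dim over F) (H \<inter> (a <# H)) = d * t"
      "(dim over F) (W \<inter> (a <# W)) = d * t \<and> 3 * l = d * t \<or>
       (dim over F) (W \<inter> (a <# W)) = (d + 1) * t \<and> d * t + (2 * m - t) \<le> 3 * l \<and> 3 * l \<le> d * t + m \<or>
       (dim over F) (W \<inter> (a <# W)) = (d + 2) * t \<and> 3 * l = d * t + 2 * m"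
      using attained by blast
    then have d: "(dim over F) (H \<inter> (a <# H)) = d * 3" "(dim over F) (W \<inter> (a <# W)) = d * 3" "d = l"
    proof -
      \<comment> \<open>For \<open>m = 2\<close> the alternatives have residues 0, then 1 or 2, then
        1 modulo 3, so a multiple of 3 can only be \<open>d * 3\<close>.\<close>
      have "3 * l \<noteq> d * 3 + 4" "\<not> (d * 3 + 1 \<le> 3 * l \<and> 3 * l \<le> d * 3 + 2)"
        by presburger+
      then show "(dim over F) (H \<inter> (a <# H)) = d * 3" "(dim over F) (W \<inter> (a <# W)) = d * 3" "d = l"
        using d 4 by auto
    qed
    \<comment> \<open>Dimension \<open>3 l\<close> is full for \<open>H\<close> but not for
      \<open>W\<close>. Since \<open>E\<close> stabilizes \<open>W\<close>, the scalar
      \<open>a\<close> lies outside \<open>E\<close>.\<close>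
    then have "a \<in> stabilizer H" "a \<notin> stabilizer W"
      using inter_l_coset_full_dim[OF fin F F_sub[OF H] a]
        inter_l_coset_full_dim[OF fin F F_sub[OF W] a] dims 4 by simp_all
    then have EH: "E \<subset> stabilizer H"
      using subalgebra_le_stabilizer[OF H fin ER] subalgebra_le_stabilizer[OF W fin ER] by blast
    have "3 * l' + 2 < l * t + m"
      using l' 4 by simp
    then obtain b d where b: "b \<in> carrier R - {\<zero>}" and
      d: "(dim over F) (H \<inter> (b <# H)) = d * t"
      "(dim over F) (W \<inter> (b <# W)) = d * t \<and> 3 * l' + 2 = d * t \<or>
       (dim over F) (W \<inter> (b <# W)) = (d + 1) * t \<and> d * t + (2 * m - t) \<le> 3 * l' + 2 \<and> 3 * l' + 2 \<le> d * t + m \<or>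
       (dim over F) (W \<inter> (b <# W)) = (d + 2) * t \<and> 3 * l' + 2 = d * t + 2 * m"
      using attained by blast
    then have "(dim over F) (H \<inter> (b <# H)) = d * 3" "d = l'"
    proof -
      \<comment> \<open>Residue 2 leaves only the middle alternative, with \<open>d = l'\<close>; so
        \<open>H\<close> and \<open>H \<inter> (b <# H)\<close> have consecutive
        \<open>E\<close>-dimensions.\<close>
      have "3 * l' + 2 \<noteq> d * 3" "3 * l' + 2 \<noteq> d * 3 + 4"
        by presburger+
      then show "(dim over F) (H \<inter> (b <# H)) = d * 3" "d = l'"
        using d 4 by auto
    qed
    then show False
      using strict_extension_no_consecutive_dims[OF fin F E KH FE EH
          stabilizer_subalgebra[OF HR fin] _
          subalgebra_inter[OF stabilizer_subalgebra[OF HR fin]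
            subalgebra_l_coset[OF subfieldE(3)[OF KH] stabilizer_subalgebra[OF HR fin]]], of l' b] b
        dims l' 4 by simp
  qed
qed

section \<open>The \<open>E\<close>-span of \<open>S\<close> and assembly of the theorem\<close>

lemma span_set_eqI:
  assumes fin: "finite (carrier R)" and E: "subfield E R" and W: "subalgebra E W R"
    and S: "S \<subseteq> W" and least: "\<And>V. subalgebra E V R \<Longrightarrow> S \<subseteq> V \<Longrightarrow> W \<subseteq> V"
  shows "span_set E S = W"
proof -
  have SR: "S \<subseteq> carrier R"
    using S subalgebra_in_carrier[OF W] by blast
  obtain us where us: "set us = S"
    using finite_list[OF finite_subset[OF SR fin]] by blast
  have "span_set E S = Span E us"
    using span_set_set[OF E, of us] us SR by (simp del: Span.simps)
  also have "\<dots> = W"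
    using Span_subalgebraI[OF E W, of us] us S least by (simp del: Span.simps)
  finally show ?thesis .
qed

end

theorem theorem6p1:
  fixes L (structure)
    and F E S Sbar :: "'a set"
    and lam b :: 'a
    and q n t m l :: nat
  assumes "field L" and "primepow q" and "finite (carrier L)" and "order L = q ^ n"
    and "subfield F L" and "card F = q"
    and "lam \<in> carrier L - F"
    and "E = generate_field L (insert lam F)" and "card E = q ^ t"
    and "subalgebra E Sbar L" and "ring.dimension L l E Sbar" and "l > 0"
    and "b \<in> carrier L - Sbar"
    and "0 < m" and "m < t"
    and "S = Sbar <+> (b <# ring.Span L F (map (\<lambda>i. lam [^] i) [0..<m]))"
    and "Sbar \<inter> (b <# ring.Span L F (map (\<lambda>i. lam [^] i) [0..<m])) = {\<zero>}"
    and "(t, m) \<noteq> (2, 1) \<or>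
         (t, m) = (2, 1) \<and> E \<subset> ring.stabilizer L (ring.span_set L E S)"
  shows "\<not> ring.full_weight_spectrum L F S"
proof -
  interpret field L by fact
  note fin = assms(3) and F = assms(5) and Sbar = assms(10)
  define V where "V = Span F (map (\<lambda>i. lam [^] i) [0..<m])"
  define W where "W = Sbar <+>\<^bsub>L\<^esub> (b <# E)"
  have FR: "insert lam F \<subseteq> carrier L"
    using subfieldE(3)[OF F] assms(7) by simp
  have E: "subfield E L" "insert lam F \<subseteq> E"
    using generate_fieldE[OF FR assms(8)] by auto
  then have FE: "F \<subseteq> E" "lam \<in> E"
    by auto
  have ER: "E \<subseteq> carrier L"
    using subfieldE(3)[OF E(1)] .
  have EE: "subalgebra E E L" "subalgebra F E L"
    using subfield_is_subalgebra[OF E(1)] FE by auto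
  interpret Sbar: subalgebra E Sbar L by (fact Sbar)
  have b: "b \<in> carrier L - {\<zero>}" "b \<notin> Sbar"
    using assms(13) Sbar.one_closed by auto
  have bE: "subalgebra E (b <# E) L" "subalgebra F (b <# E) L"
    using subalgebra_l_coset b(1) ER EE FE(1) by (blast intro: subalgebra_mono_field)+
  have "lam [^] i \<in> E" for i :: nat
    using FE(2) subringE(3,6)[OF subfieldE(1)[OF E(1)]] by (induction i) auto
  then have pow: "set (map (\<lambda>i. lam [^] i) [0..<m]) \<subseteq> E"
    by auto
  have V: "subalgebra F V L" "V \<subseteq> E"
    unfolding V_def using Span_is_subalgebra[OF F] subalgebra_Span_incl[OF F EE(2) pow] pow ER by blast+
  have bV: "subalgebra F (b <# V) L" "b <# V \<subseteq> b <# E"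
    using subalgebra_l_coset[OF _ V(1)] b(1) FE ER V(2) by (auto simp: l_coset_def)
  have FSbar: "subalgebra F Sbar L"
    using subalgebra_mono_field[OF Sbar FE(1)] .
  have S_eq: "S = Sbar <+>\<^bsub>L\<^esub> (b <# V)"
    using assms(16) by (simp add: V_def)
  have S: "subalgebra F S L"
    unfolding S_eq using subalgebra_set_add[OF _ FSbar bV(1)] FE ER by blast
  have W: "subalgebra E W L"
    unfolding W_def using subalgebra_set_add[OF ER Sbar bE(1)] .
  have sub: "Sbar \<subseteq> S" "S \<subseteq> W"
    unfolding S_eq W_def using subalgebra_set_add_upper(1)[OF FSbar bV(1)] bV(2)
    by (simp, unfold set_add_def', blast)
  have q: "2 \<le> q"
    using subfield_card_ge_2[OF F fin] assms(6) by simp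
  have dE: "(dim over F) E = t"
    using card_eq_power_dim[OF fin F EE(2)] assms(6,9) q by simp
  have dV: "(dim over F) V = m"
    unfolding V_def using dim_Span_powers[OF fin F, of lam m] assms(7,8,15) dE by simp
  have one_V: "\<one> \<in> V"
  proof -
    have "lam [^] (0::nat) \<in> set (map (\<lambda>i. lam [^] i) [0..<m])"
      using assms(14) by force
    then show ?thesis
      using Span_base_incl[OF F subset_trans[OF pow ER]] unfolding V_def by auto
  qed
  have dSbar: "(dim over F) Sbar = l * t"
    using dim_tower[OF fin F E(1) FE(1) Sbar] dimI[OF E(1) assms(11)] dE by simp
  have zero: "subalgebra F {\<zero>} L" "(dim over F) {\<zero>} = 0"
    using Span_is_subalgebra[OF F, of "[]"] dimI[OF F zero_dim] by simp_all
  \<comment> \<open>A nonzero common element \<open>b \<otimes> e\<close> could be divided by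
    \<open>e \<in> E\<close> inside the \<open>E\<close>-space \<open>Sbar\<close>, giving
    \<open>b \<in> Sbar\<close>.\<close>
  have inter_bE: "Sbar \<inter> (b <# E) = {\<zero>}"
  proof -
    have "x = \<zero>" if x: "x \<in> Sbar" "x \<in> b <# E" for x
    proof (rule ccontr)
      assume "x \<noteq> \<zero>"
      obtain e where e: "e \<in> E" "x = b \<otimes> e"
        using x by (auto simp: l_coset_def)
      then have "e \<in> E - {\<zero>}"
        using \<open>x \<noteq> \<zero>\<close> b by auto
      note i = subfield_m_inv[OF E(1) this]
      have "inv e \<otimes> x \<in> Sbar"
        using Sbar.smult_closed i x by blast
      moreover have "inv e \<otimes> x = b"
        using e i b ER by (auto simp: m_lcomm[of "inv e" b e] subset_iff)
      ultimately show False
        using b(2) by simp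
    qed
    moreover have "\<zero> \<in> Sbar" "\<zero> \<in> b <# E"
      using Sbar.one_closed subgroup.one_closed[OF subalgebra.axioms(1)[OF bE(1)]] by auto
    ultimately show ?thesis
      by blast
  qed
  have dW: "(dim over F) W = (l + 1) * t"
    using dim_add_dim_inter[OF fin F FSbar bE(2)] dim_l_coset[OF fin F EE(2) b(1)] dSbar dE zero
    by (simp add: W_def inter_bE)
  have dS: "(dim over F) S = l * t + m"
    using dim_add_dim_inter[OF fin F FSbar bV(1)] dim_l_coset[OF fin F V(1) b(1)] dSbar dV zero
      assms(17)[folded V_def] by (simp add: S_eq)
  have "span_set E S = W"
  proof (rule span_set_eqI[OF fin E(1) W sub(2)])
    fix U assume U: "subalgebra E U L" "S \<subseteq> U"
    \<comment> \<open>As \<open>m > 0\<close>, the power \<open>\<one>\<close> belongs to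
      \<open>V\<close> and hence \<open>b\<close> to \<open>S\<close>; an \<open>E\<close>-space
      containing \<open>S\<close> therefore contains both \<open>Sbar\<close> and
      \<open>b <# E\<close>.\<close>
    have "b \<otimes> \<one> \<in> b <# V"
      using one_V by (auto simp: l_coset_def)
    then have "b \<in> U"
      using U(2) subalgebra_set_add_upper(2)[OF FSbar bV(1)] b by (auto simp: S_eq)
    then have "b <# E \<subseteq> U"
      using subalgebra.smult_closed[OF U(1)] ER b by (auto simp: l_coset_def m_comm subset_iff)
    then show "W \<subseteq> U"
      unfolding W_def using subalgebra_set_add_least[OF U(1)] sub U(2) by blast
  qed
  then show ?thesis
    using not_full_weight_spectrum[OF fin F E(1) FE(1) Sbar W S sub dE dSbar dW dS] assms(12,14,15,18)
    by auto
qed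

end
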